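(* Let $A\in M_{n\times n}(\mathbb C)$ be a scalar matrix and let $\Lambda=(\Lambda_1,\ldots,\Lambda_n)$ be an $n$-tuple of power series in noncommuting indeterminates $Z_1,\ldots,Z_n$, of the form $$\Lambda=[Z_1,\ldots,Z_n]A+[\Gamma_1,\ldots,\Gamma_n],$$ where $\Gamma_1,\ldots,\Gamma_n$ are noncommutative power series containing only monomials of degree greater than or equal to $2$. If there is a noncommutative power series $F$ which is not identically zero and satisfies the Schröder type equation $$F\circ\Lambda=cF$$ for some $c\in\mathbb C$, then either $c=1$ or $c$ is a product of eigenvalues of the matrix $A$.
   Context: $n\ge1$. $\mathbb F_n^+$ is the free semigroup with generators $g_1,\ldots,g_n$ and identity $g_0$; $|g_0|=0$, $|\alpha|=k$ if $\alpha=g_{i_1}\cdots g_{i_k}$; $Z_\alpha:=Z_{i_1}\cdots Z_{i_k}$, $Z_{g_0}:=1$. Noncommutative power series are formal series $F=\sum_{k=0}^\infty\sum_{|\alpha|=k}c_\alpha Z_\alpha$ with complex coefficients. $[Z_1,\ldots,Z_n]A$ is the $n$-tuple with $j$-th entry $\sum_ia_{ij}Z_i$, where $A=[a_{ij}]$. Since each $\Lambda_j$ has zero constant term, the composition $F\circ\Lambda:=\sum_{k=0}^\infty\sum_{|\alpha|=k}c_\alpha\Lambda_\alpha$, $\Lambda_\alpha:=\Lambda_{i_1}\cdots\Lambda_{i_k}$, is a well defined formal power series. "A product of eigenvalues of $A$" means a product $\mu_1\cdots\mu_k$, $k\ge1$, of (not necessarily distinct) eigenvalues of $A$. *)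

theory Defs
  imports "HOL-Analysis.Analysis" "HOL-Library.Groups_Big_Fun"
begin

text \<open>
  The free semigroup with identity on the generators \<open>g\<^sub>i\<close>, \<open>i :: 'n\<close>, is the type
  \<open>'n list\<close> of words: the identity \<open>g\<^sub>0\<close> is \<open>[]\<close> and \<open>\<bar>\<alpha>\<bar>\<close> is \<open>length \<alpha>\<close>.  A noncommutative
  power series is its family of coefficients \<open>c\<^sub>\<alpha>\<close>.
\<close>

typedef 'n ncps = "UNIV :: ('n list \<Rightarrow> complex) set"
  morphisms nc_coeff Abs_ncps ..

lemma nc_coeff_Abs [simp]: "nc_coeff (Abs_ncps f) = f"
  by (simp add: Abs_ncps_inverse)

lemma ncps_eqI: "(\<And>w. nc_coeff F w = nc_coeff G w) \<Longrightarrow> F = G"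
  by (simp add: nc_coeff_inject[symmetric] fun_eq_iff)

instantiation ncps :: (type) "{zero, one, plus, minus, uminus, times}"
begin

definition "0 = Abs_ncps (\<lambda>w. 0)"
definition "1 = Abs_ncps (\<lambda>w. if w = [] then 1 else 0)"
definition "F + G = Abs_ncps (\<lambda>w. nc_coeff F w + nc_coeff G w)"
definition "F - G = Abs_ncps (\<lambda>w. nc_coeff F w - nc_coeff G w)"
definition "- F = Abs_ncps (\<lambda>w. - nc_coeff F w)"

text \<open>Cauchy product: the sum runs over all factorizations \<open>w = u @ v\<close>.\<close>

definition "F * G =
  Abs_ncps (\<lambda>w. \<Sum>i\<le>length w. nc_coeff F (take i w) * nc_coeff G (drop i w))"

instance ..

end

lemma nc_coeff_0 [simp]: "nc_coeff 0 w = 0"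
  and nc_coeff_1: "nc_coeff 1 w = (if w = [] then 1 else 0)"
  and nc_coeff_add [simp]: "nc_coeff (F + G) w = nc_coeff F w + nc_coeff G w"
  and nc_coeff_diff [simp]: "nc_coeff (F - G) w = nc_coeff F w - nc_coeff G w"
  and nc_coeff_minus [simp]: "nc_coeff (- F) w = - nc_coeff F w"
  and nc_coeff_mult:
    "nc_coeff (F * G) w = (\<Sum>i\<le>length w. nc_coeff F (take i w) * nc_coeff G (drop i w))"
  by (simp_all add: zero_ncps_def one_ncps_def plus_ncps_def minus_ncps_def uminus_ncps_def
      times_ncps_def)

instance ncps :: (type) ring_1
proof
  fix F G H :: "'a ncps"
  show "F * G * H = F * (G * H)"
  proof (rule ncps_eqI)
    fix w :: "'a list"
    define t where "t i j = nc_coeff F (take i w) * nc_coeff G (drop i (take j w)) *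
      nc_coeff H (drop j w)" for i j
    have "nc_coeff (F * G * H) w = (\<Sum>j\<le>length w. \<Sum>i\<le>j. t i j)"
      by (auto simp: nc_coeff_mult t_def sum_distrib_right min_def intro!: sum.cong)
    also have "\<dots> = (\<Sum>i\<le>length w. \<Sum>j\<in>{i..length w}. t i j)"
      unfolding sum.Sigma[OF finite_atMost ballI[OF finite_atMost]]
        sum.Sigma[OF finite_atMost ballI[OF finite_atLeastAtMost]]
      by (rule sum.reindex_bij_witness[where i = "\<lambda>(i, j). (j, i)" and j = "\<lambda>(i, j). (j, i)"]) auto
    also have "\<dots> = (\<Sum>i\<le>length w. \<Sum>k\<le>length w - i. t i (i + k))"
    proof (rule sum.cong[OF refl])
      fix i assume "i \<in> {..length w}"
      then show "(\<Sum>j\<in>{i..length w}. t i j) = (\<Sum>k\<le>length w - i. t i (i + k))"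
        by (intro sum.reindex_bij_witness[where i = "\<lambda>k. i + k" and j = "\<lambda>j. j - i"]) auto
    qed
    also have "\<dots> = nc_coeff (F * (G * H)) w"
      by (auto simp: nc_coeff_mult t_def sum_distrib_left drop_take mult.assoc add.commute
          intro!: sum.cong)
    finally show "nc_coeff (F * G * H) w = nc_coeff (F * (G * H)) w" .
  qed
  show "1 * F = F"
  proof (rule ncps_eqI)
    fix w :: "'a list"
    have "nc_coeff (1 * F) w = (\<Sum>i\<le>length w. if i = 0 then nc_coeff F w else 0)"
      unfolding nc_coeff_mult by (rule sum.cong) (auto simp: nc_coeff_1)
    then show "nc_coeff (1 * F) w = nc_coeff F w" by simp
  qed
  show "F * 1 = F"
  proof (rule ncps_eqI)
    fix w :: "'a list"
    have "nc_coeff (F * 1) w = (\<Sum>i\<le>length w. if i = length w then nc_coeff F w else 0)"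
      unfolding nc_coeff_mult by (rule sum.cong) (auto simp: nc_coeff_1)
    then show "nc_coeff (F * 1) w = nc_coeff F w" by simp
  qed
  show "(0 :: 'a ncps) \<noteq> 1"
    by (metis nc_coeff_0 nc_coeff_1 zero_neq_one)
qed (auto intro!: ncps_eqI simp: nc_coeff_mult algebra_simps sum.distrib)

definition nc_var :: "'n \<Rightarrow> 'n ncps" where
  "nc_var i = Abs_ncps (\<lambda>w. if w = [i] then 1 else 0)"

definition nc_scale :: "complex \<Rightarrow> 'n ncps \<Rightarrow> 'n ncps" where
  "nc_scale c F = Abs_ncps (\<lambda>w. c * nc_coeff F w)"

definition nc_word :: "('n \<Rightarrow> 'm ncps) \<Rightarrow> 'n list \<Rightarrow> 'm ncps" where
  "nc_word \<Lambda> \<alpha> = prod_list (map \<Lambda> \<alpha>)"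

text \<open>
  The coefficient of a word in \<open>\<Sum>\<^sub>\<alpha> c\<^sub>\<alpha> \<Lambda>\<^sub>\<alpha>\<close>.  \<open>Sum_any\<close> is the sum over the support of its
  argument, provided that it is finite; this is the case if the alphabet is finite and all the
  \<open>\<Lambda>\<^sub>j\<close> have zero constant term, see the lemmas below.
\<close>

definition nc_compose :: "'n ncps \<Rightarrow> ('n \<Rightarrow> 'm ncps) \<Rightarrow> 'm ncps" where
  "nc_compose F \<Lambda> =
    Abs_ncps (\<lambda>w. Sum_any (\<lambda>\<alpha>. nc_coeff F \<alpha> * nc_coeff (nc_word \<Lambda> \<alpha>) w))"

text \<open>The row vector \<open>[Z\<^sub>1, \<dots>, Z\<^sub>n] A\<close>.\<close>

definition nc_linear :: "complex ^ 'n ^ 'n \<Rightarrow> 'n::finite \<Rightarrow> 'n ncps" where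
  "nc_linear A j = (\<Sum>i\<in>UNIV. nc_scale (A $ i $ j) (nc_var i))"

definition matrix_eigenvalue :: "complex ^ 'n ^ 'n \<Rightarrow> complex \<Rightarrow> bool" where
  "matrix_eigenvalue A \<mu> \<longleftrightarrow> (\<exists>v. v \<noteq> 0 \<and> A *v v = \<mu> *s v)"

lemma nc_coeff_scale [simp]: "nc_coeff (nc_scale c F) w = c * nc_coeff F w"
  by (simp add: nc_scale_def)

lemma nc_coeff_var: "nc_coeff (nc_var i) w = (if w = [i] then 1 else 0)"
  by (simp add: nc_var_def)

lemma nc_word_var: "nc_coeff (nc_word nc_var \<alpha>) w = (if w = \<alpha> then 1 else 0)"
proof (induction \<alpha> arbitrary: w)
  case Nil
  then show ?case by (simp add: nc_word_def nc_coeff_1)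
next
  case (Cons a \<alpha>)
  have "nc_coeff (nc_word nc_var (a # \<alpha>)) w =
      (\<Sum>i\<le>length w. if i = 1 then (if w = a # \<alpha> then 1 else 0) else 0)"
    unfolding nc_word_def list.map prod_list.Cons nc_coeff_mult
  proof (rule sum.cong[OF refl])
    fix i assume "i \<in> {..length w}"
    then show "nc_coeff (nc_var a) (take i w) * nc_coeff (prod_list (map nc_var \<alpha>)) (drop i w) =
        (if i = 1 then if w = a # \<alpha> then 1 else 0 else 0)"
      using Cons.IH[of "drop i w"]
      by (cases w; cases i) (auto simp: nc_coeff_var nc_word_def)
  qed
  also have "\<dots> = (if w = a # \<alpha> then 1 else 0)"
    by auto
  finally show ?case .
qed

lemma nc_word_coeff_short:
  assumes "\<And>j. nc_coeff (\<Lambda> j) [] = 0" "length w < length \<alpha>"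
  shows "nc_coeff (nc_word \<Lambda> \<alpha>) w = 0"
  using assms(2)
proof (induction \<alpha> arbitrary: w)
  case (Cons a \<alpha>)
  have "nc_coeff (\<Lambda> a) (take i w) * nc_coeff (nc_word \<Lambda> \<alpha>) (drop i w) = 0"
    if "i \<le> length w" for i
    using that Cons assms(1) by (cases i) auto
  then show ?case
    unfolding nc_word_def list.map prod_list.Cons nc_coeff_mult by (intro sum.neutral) auto
qed simp

lemma finite_words_le: "finite {\<alpha> :: 'n::finite list. length \<alpha> \<le> k}"
  using finite_lists_length_le[of "UNIV :: 'n set" k] by simp

lemma nc_compose_finite_support:
  fixes \<Lambda> :: "'n::finite \<Rightarrow> 'm ncps"
  assumes "\<And>j. nc_coeff (\<Lambda> j) [] = 0"
  shows "finite {\<alpha>. nc_coeff F \<alpha> * nc_coeff (nc_word \<Lambda> \<alpha>) w \<noteq> 0}"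
  by (rule finite_subset[OF _ finite_words_le[of "length w"]])
    (auto intro: nc_word_coeff_short[OF assms] simp: not_le[symmetric])

lemma nc_coeff_compose:
  fixes \<Lambda> :: "'n::finite \<Rightarrow> 'm ncps"
  assumes "\<And>j. nc_coeff (\<Lambda> j) [] = 0"
  shows "nc_coeff (nc_compose F \<Lambda>) w =
    (\<Sum>k\<le>length w. \<Sum>\<alpha> | length \<alpha> = k. nc_coeff F \<alpha> * nc_coeff (nc_word \<Lambda> \<alpha>) w)"
proof -
  have "nc_coeff (nc_compose F \<Lambda>) w =
      (\<Sum>\<alpha> | length \<alpha> \<le> length w. nc_coeff F \<alpha> * nc_coeff (nc_word \<Lambda> \<alpha>) w)"
    unfolding nc_compose_def nc_coeff_Abs
    by (rule Sum_any.expand_superset[OF finite_words_le])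
      (auto intro: nc_word_coeff_short[OF assms] simp: not_le[symmetric])
  also have "\<dots> = (\<Sum>\<alpha> \<in> (\<Union>k\<le>length w. {\<alpha>. length \<alpha> = k}).
      nc_coeff F \<alpha> * nc_coeff (nc_word \<Lambda> \<alpha>) w)"
    by (rule sum.cong) auto
  also have "\<dots> =
      (\<Sum>k\<le>length w. \<Sum>\<alpha> | length \<alpha> = k. nc_coeff F \<alpha> * nc_coeff (nc_word \<Lambda> \<alpha>) w)"
    by (subst sum.UNION_disjoint) (auto intro: finite_subset[OF _ finite_words_le])
  finally show ?thesis .
qed

end

theory Submission
  imports Defs "HOL-Computational_Algebra.Fundamental_Theorem_Algebra"
begin

text \<open>
  Let \<open>k\<close> be the least degree in which \<open>F\<close> has a nonzero coefficient.  In degree \<open>k\<close> the higher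
  order terms \<open>\<Gamma>\<close> do not contribute, so the degree \<open>k\<close> part of \<open>F\<close> is an eigenvector of the
  \<open>k\<close>-fold Kronecker power of \<open>A\<close> with eigenvalue \<open>c\<close>.  To split off one tensor factor, note that
  \<open>A\<close> acting on the first factor commutes with this Kronecker power, hence has an eigenvector
  inside its eigenspace for \<open>c\<close>.
\<close>

section \<open>Polynomials in a matrix, applied to a vector\<close>

definition mat_poly :: "complex ^ 'n ^ 'n \<Rightarrow> complex poly \<Rightarrow> complex ^ 'n \<Rightarrow> complex ^ 'n" where
  "mat_poly A p v = (\<Sum>i\<le>degree p. coeff p i *s (((*v) A) ^^ i) v)"

lemma mat_poly_eq:
  assumes "degree p \<le> N"
  shows "mat_poly A p v = (\<Sum>i\<le>N. coeff p i *s (((*v) A) ^^ i) v)"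
  unfolding mat_poly_def
  by (rule sum.mono_neutral_left) (use assms in \<open>auto simp: coeff_eq_0\<close>)

lemma matrix_vector_mult_vsum:
  fixes A :: "complex ^ 'n ^ 'm"
  shows "A *v (\<Sum>i\<in>S. f i) = (\<Sum>i\<in>S. A *v f i)"
  by (induction S rule: infinite_finite_induct) (auto simp: matrix_vector_right_distrib)

lemma funpow_matrix_vector_diff_scale:
  fixes A :: "complex ^ 'n ^ 'n"
  shows "(((*v) A) ^^ i) (A *v v - l *s v) = (((*v) A) ^^ Suc i) v - l *s (((*v) A) ^^ i) v"
  by (induction i) (auto simp: matrix_vector_mult_diff_distrib vector_scalar_commute)

text \<open>Multiplying \<open>q\<close> by the indeterminate shifts its coefficients and so adds
  one application of \<open>A\<close>, which commutes with the iterates already present. Used to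
  strip one root at a time off an annihilating polynomial.\<close>

lemma mat_poly_linear_factor:
  "mat_poly A ([:-l, 1:] * q) v = mat_poly A q (A *v v - l *s v)"
proof -
  define N where "N = degree q"
  have c: "coeff ([:-l, 1:] * q) i = coeff (pCons 0 q) i - l * coeff q i" for i
    by simp
  have d: "degree ([:-l, 1:] * q) \<le> Suc N"
    using degree_mult_le[of "[:-l, 1:]" q] by (simp add: N_def)
  have "mat_poly A ([:-l, 1:] * q) v =
      (\<Sum>i\<le>Suc N. coeff (pCons 0 q) i *s (((*v) A) ^^ i) v)
        - (\<Sum>i\<le>Suc N. (l * coeff q i) *s (((*v) A) ^^ i) v)"
    unfolding mat_poly_eq[OF d] c by (simp only: vector_sub_rdistrib sum_subtractf)
  also have "(\<Sum>i\<le>Suc N. coeff (pCons 0 q) i *s (((*v) A) ^^ i) v) =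
      (\<Sum>i\<le>N. coeff q i *s (((*v) A) ^^ Suc i) v)"
    by (subst sum.atMost_Suc_shift) simp
  \<comment> \<open>The top term vanishes because \<open>Suc N\<close> exceeds
    \<open>degree q\<close>.\<close>
  also have "(\<Sum>i\<le>Suc N. (l * coeff q i) *s (((*v) A) ^^ i) v) =
      (\<Sum>i\<le>N. (l * coeff q i) *s (((*v) A) ^^ i) v)"
    by (simp add: N_def coeff_eq_0)
  also have "(\<Sum>i\<le>N. coeff q i *s (((*v) A) ^^ Suc i) v) - \<dots> =
      mat_poly A q (A *v v - l *s v)"
    unfolding mat_poly_def N_def[symmetric] funpow_matrix_vector_diff_scale sum_subtractf[symmetric]
    by (rule sum.cong) (simp_all add: vec_eq_iff algebra_simps)
  finally show ?thesis .
qed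

text \<open>
  The matrices form a finite-dimensional real vector space, so even a real polynomial will do.
\<close>

lemma annihilating_poly_exists:
  fixes A :: "complex ^ 'n ^ 'n"
  shows "\<exists>p. p \<noteq> 0 \<and> (\<forall>v. mat_poly A p v = 0)"
proof -
  define M where "M i = (((**) A) ^^ i) (mat 1)" for i :: nat
  have M: "M i *v v = (((*v) A) ^^ i) v" for i v
    by (induction i) (auto simp: M_def matrix_vector_mul_assoc[symmetric])
  define d where "d = DIM(complex ^ 'n ^ 'n)"
  \<comment> \<open>There are \<open>d + 1\<close> powers of \<open>A\<close> in a real space of
    dimension \<open>d\<close>. The dimension count concerns sets, so coinciding powers are treated
    separately.\<close>
  obtain r :: "nat \<Rightarrow> real" and i where
    r: "(\<Sum>i\<le>d. r i *\<^sub>R M i) = 0" and i: "i \<le> d" "r i \<noteq> 0"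
  proof (cases "inj_on M {..d}")
    case True
    have "card (M ` {..d}) = Suc d"
      by (simp add: card_image[OF True])
    then have "dependent (M ` {..d})"
      by (intro dependent_biggerset) (simp add: d_def)
    then obtain u X where u: "(\<Sum>X\<in>M ` {..d}. u X *\<^sub>R X) = 0" "X \<in> M ` {..d}" "u X \<noteq> 0"
      by (auto simp: dependent_finite)
    show thesis
      using u that[of "\<lambda>i. u (M i)"] by (auto simp: sum.reindex[OF True])
  next
    case False
    then obtain i j where ij: "i \<le> d" "j \<le> d" "i \<noteq> j" "M i = M j"
      by (auto simp: inj_on_def)
    \<comment> \<open>Two equal powers give a relation directly: coefficient 1 at \<open>i\<close>
      and -1 at \<open>j\<close>.\<close>
    have "(\<Sum>k\<le>d. ((if k = i then 1 else 0) - (if k = j then 1 else 0)) *\<^sub>R M k) =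
        (\<Sum>k\<le>d. (if k = i then M k else 0)) - (\<Sum>k\<le>d. (if k = j then M k else 0))"
      unfolding sum_subtractf[symmetric] by (rule sum.cong) auto
    also have "\<dots> = 0"
      using ij by simp
    finally show thesis
      using that[of "\<lambda>k. (if k = i then 1 else 0) - (if k = j then 1 else 0)" i] ij by auto
  qed
  define p where "p = (\<Sum>i\<le>d. monom (complex_of_real (r i)) i)"
  have c: "coeff p k = (if k \<le> d then of_real (r k) else 0)" for k
    by (simp add: p_def coeff_sum)
  have deg: "degree p \<le> d"
    by (rule degree_le) (simp add: c)
  have "mat_poly A p v = 0" for v
  proof -
    have "mat_poly A p v = (\<Sum>i\<le>d. (r i *\<^sub>R M i) *v v)"
      unfolding mat_poly_eq[OF deg]
    proof (rule sum.cong[OF refl])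
      fix k assume "k \<in> {..d}"
      then show "coeff p k *s (((*v) A) ^^ k) v = (r k *\<^sub>R M k) *v v"
        by (simp add: M[symmetric] c vec_eq_iff matrix_vector_mult_def sum_distrib_left
            scaleR_conv_of_real[where 'a = complex] mult.assoc)
    qed
    also have "\<dots> = (\<Sum>i\<le>d. r i *\<^sub>R M i) *v v"
      by (simp add: vec_eq_iff matrix_vector_mult_def sum_distrib_right) (rule allI, rule sum.swap)
    finally show ?thesis
      by (simp add: r)
  qed
  moreover have "p \<noteq> 0"
    using c[of i] i by auto
  ultimately show ?thesis
    by blast
qed

section \<open>Splitting off one tensor factor\<close>

text \<open>Apply the factors \<open>A - l\<close> of an annihilating polynomial one after another;
  the last family that is still nonzero somewhere on \<open>W\<close> consists of eigenvectors. The
  polynomial does not depend on \<open>u\<close>, so all members share one eigenvalue.\<close>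

lemma eigenvector_in_invariant_set:
  fixes A :: "complex ^ 'n ^ 'n" and V :: "('b \<Rightarrow> complex ^ 'n) \<Rightarrow> bool"
  assumes V: "\<And>g l. V g \<Longrightarrow> V (\<lambda>u. A *v g u - l *s g u)"
    and g: "V g" "\<exists>u\<in>W. g u \<noteq> 0"
  obtains h \<mu> where "V h" "\<exists>u\<in>W. h u \<noteq> 0" "\<And>u. u \<in> W \<Longrightarrow> A *v h u = \<mu> *s h u"
proof -
  obtain p where p: "p \<noteq> 0" "\<And>v. mat_poly A p v = 0"
    using annihilating_poly_exists by blast
  \<comment> \<open>The polynomial has to annihilate only the values of \<open>g\<close> on
    \<open>W\<close>: after a root is removed, the quotient is known to annihilate the new family,
    not all vectors.\<close>
  have "\<exists>h \<mu>. V h \<and> (\<exists>u\<in>W. h u \<noteq> 0) \<and> (\<forall>u\<in>W. A *v h u = \<mu> *s h u)"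
    if "p \<noteq> 0" "\<forall>u\<in>W. mat_poly A p (g u) = 0" for p
    using that g
  proof (induction "degree p" arbitrary: p g)
    case 0
    then obtain a where "p = [:a:]"
      by (metis degree_eq_zeroE)
    \<comment> \<open>A nonzero constant cannot annihilate a nonzero value of
      \<open>g\<close>.\<close>
    with 0 show ?case
      by (auto simp: mat_poly_def)
  next
    case (Suc n)
    then have "\<not> constant (poly p)"
      by (simp add: constant_degree)
    then obtain l where "poly p l = 0"
      using fundamental_theorem_of_algebra by blast
    then obtain q where q: "p = [:-l, 1:] * q"
      by (auto simp: poly_eq_0_iff_dvd)
    with Suc.prems have "q \<noteq> 0"
      by auto
    with q Suc.hyps(2) have "n = degree q"
      by (simp add: degree_mult_eq del: mult_pCons_left)
    show ?case
    proof (cases "\<exists>u\<in>W. A *v g u - l *s g u \<noteq> 0")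
      case True
      then show ?thesis
        using Suc.hyps(1)[OF \<open>n = degree q\<close> \<open>q \<noteq> 0\<close>, of "\<lambda>u. A *v g u - l *s g u"]
          Suc.prems(2,3) V
        unfolding q mat_poly_linear_factor by blast
    next
      \<comment> \<open>Now \<open>g\<close> itself is the required family, with eigenvalue
        \<open>l\<close>.\<close>
      case False
      then show ?thesis
        using Suc.prems by auto
    qed
  qed
  then show thesis
    using p g that by blast
qed

text \<open>The hypothesis makes \<open>g\<close> an eigenvector of the Kronecker product of
  \<open>A\<close> and \<open>K\<close>. Choosing it to be an eigenvector of \<open>A\<close> in the
  first factor as well, with eigenvalue \<mu>, leaves \<mu> times \<open>K\<close> acting with
  eigenvalue \<open>c\<close>.\<close>

lemma kronecker_eigenvalue:
  fixes A :: "complex ^ 'n ^ 'n" and K :: "'b \<Rightarrow> 'b \<Rightarrow> complex"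
  assumes eq: "\<forall>u\<in>W. A *v (\<Sum>v\<in>W. K u v *s g v) = c *s g u"
    and g: "\<exists>u\<in>W. g u \<noteq> 0"
  obtains (zero) "c = 0" "matrix_eigenvalue A 0"
  | (mult) \<mu> d h where "matrix_eigenvalue A \<mu>" "c = \<mu> * d" "\<exists>u\<in>W. h u \<noteq> 0"
      "\<And>u. u \<in> W \<Longrightarrow> (\<Sum>v\<in>W. K u v * h v) = d * h u"
proof -
  \<comment> \<open>The eigenspace for \<open>c\<close>; it is invariant because \<open>A\<close>
    acts on values and \<open>K\<close> on indices, so the two actions commute.\<close>
  define V where "V g \<longleftrightarrow> (\<forall>u\<in>W. A *v (\<Sum>v\<in>W. K u v *s g v) = c *s g u)"
    for g :: "'b \<Rightarrow> complex ^ 'n"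
  have V: "V (\<lambda>u. A *v g u - l *s g u)" if "V g" for g l
    unfolding V_def
  proof
    fix u assume u: "u \<in> W"
    have "(\<Sum>v\<in>W. K u v *s (A *v g v - l *s g v)) =
        A *v (\<Sum>v\<in>W. K u v *s g v) - l *s (\<Sum>v\<in>W. K u v *s g v)"
      unfolding matrix_vector_mult_vsum vec.scale_sum_right sum_subtractf[symmetric]
      by (rule sum.cong) (simp_all add: vector_scalar_commute vec_eq_iff algebra_simps)
    then show "A *v (\<Sum>v\<in>W. K u v *s (A *v g v - l *s g v)) = c *s (A *v g u - l *s g u)"
      using that u
      by (simp add: V_def matrix_vector_mult_diff_distrib vector_scalar_commute
          vector_ssub_ldistrib mult.commute)
  qed
  have "V g"
    using eq by (simp add: V_def)
  then obtain h \<mu> where h: "V h" "\<exists>u\<in>W. h u \<noteq> 0" "\<And>u. u \<in> W \<Longrightarrow> A *v h u = \<mu> *s h u"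
    using eigenvector_in_invariant_set[of V A g W] V g by blast
  then obtain u0 where u0: "u0 \<in> W" "h u0 \<noteq> 0"
    by blast
  then have ev: "matrix_eigenvalue A \<mu>"
    using h(3) unfolding matrix_eigenvalue_def by blast
  have mu: "\<mu> *s (\<Sum>v\<in>W. K u v *s h v) = c *s h u" if "u \<in> W" for u
  proof -
    have "\<mu> *s (\<Sum>v\<in>W. K u v *s h v) = A *v (\<Sum>v\<in>W. K u v *s h v)"
      unfolding matrix_vector_mult_vsum vec.scale_sum_right
      by (rule sum.cong) (simp_all add: vector_scalar_commute h(3) mult.commute)
    then show ?thesis
      using h(1) that by (simp add: V_def)
  qed
  show thesis
  proof (cases "\<mu> = 0")
    \<comment> \<open>Division by \<mu> is impossible here, but evaluating at \<open>u0\<close>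
      forces \<open>c = 0\<close>, which is then itself an eigenvalue.\<close>
    case True
    with mu[OF u0(1)] u0(2) ev show thesis
      by (intro zero) auto
  next
    case False
    \<comment> \<open>A coordinate that does not vanish at \<open>u0\<close> turns the vector-valued
      family into a scalar eigenvector of \<open>K\<close>.\<close>
    obtain i where i: "h u0 $ i \<noteq> 0"
      using u0(2) by (auto simp: vec_eq_iff)
    show thesis
    proof (rule mult[OF ev])
      show "c = \<mu> * (c / \<mu>)"
        using False by simp
      show "\<exists>u\<in>W. h u $ i \<noteq> 0"
        using u0(1) i by blast
      fix u assume "u \<in> W"
      from arg_cong[OF mu[OF this], of "\<lambda>x. x $ i"]
      show "(\<Sum>v\<in>W. K u v * h v $ i) = c / \<mu> * h u $ i"
        using False by (simp add: field_simps)
    qed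
  qed
qed

section \<open>Kronecker powers of a matrix, indexed by words\<close>

text \<open>The entry in row \<open>w\<close> and column \<alpha> of the Kronecker power. Words of
  equal length are intended, as \<open>map2\<close> truncates to the shorter one.\<close>

definition kronecker_power :: "'a::comm_monoid_mult ^ 'n ^ 'n \<Rightarrow> 'n list \<Rightarrow> 'n list \<Rightarrow> 'a" where
  "kronecker_power A w \<alpha> = prod_list (map2 (\<lambda>i j. A $ i $ j) w \<alpha>)"

lemma kronecker_power_Nil [simp]: "kronecker_power A [] [] = 1"
  and kronecker_power_Cons [simp]:
    "kronecker_power A (i # w) (j # \<alpha>) = A $ i $ j * kronecker_power A w \<alpha>"
  by (simp_all add: kronecker_power_def)

lemma sum_words_Suc:
  fixes f :: "'n::finite list \<Rightarrow> 'a::comm_monoid_add"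
  shows "(\<Sum>\<alpha> | length \<alpha> = Suc k. f \<alpha>) = (\<Sum>j\<in>UNIV. \<Sum>\<beta> | length \<beta> = k. f (j # \<beta>))"
proof -
  have "{\<alpha> :: 'n list. length \<alpha> = Suc k} =
      (\<lambda>(j, \<beta>). j # \<beta>) ` (UNIV \<times> {\<beta>. length \<beta> = k})"
    by (auto simp: length_Suc_conv)
  moreover have "inj_on (\<lambda>(j, \<beta>). j # \<beta>) (UNIV \<times> {\<beta> :: 'n list. length \<beta> = k})"
    by (auto simp: inj_on_def)
  ultimately show ?thesis
    by (simp add: sum.reindex sum.cartesian_product case_prod_unfold)
qed

text \<open>Induction on \<open>k\<close>: reading off the first letter turns \<open>f\<close> into
  a family of vectors indexed by words of length \<open>k\<close>, and
  \<open>kronecker_eigenvalue\<close> peels off one factor. Both \<open>c\<close> and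
  \<open>f\<close> change on the way.\<close>

lemma kronecker_power_eigenvalue:
  fixes A :: "complex ^ 'n ^ 'n" and f :: "'n list \<Rightarrow> complex"
  assumes "\<And>w. length w = k \<Longrightarrow>
      (\<Sum>\<alpha> | length \<alpha> = k. kronecker_power A w \<alpha> * f \<alpha>) = c * f w"
    and "\<exists>w. length w = k \<and> f w \<noteq> 0"
  shows "\<exists>\<mu>s. (\<forall>\<mu>\<in>set \<mu>s. matrix_eigenvalue A \<mu>) \<and> c = prod_list \<mu>s"
  using assms
proof (induction k arbitrary: c f)
  case 0
  \<comment> \<open>The zeroth power is the 1 by 1 identity, which gives the empty product.\<close>
  then have "c = 1"
    using "0.prems"(1)[of "[]"] by simp
  then show ?case
    by (intro exI[of _ "[]"]) simp
next
  case (Suc k)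
  define W where "W = {w :: 'n list. length w = k}"
  define g :: "'n list \<Rightarrow> complex ^ 'n" where "g u = (\<chi> j. f (j # u))" for u
  have g: "\<forall>u\<in>W. A *v (\<Sum>v\<in>W. kronecker_power A u v *s g v) = c *s g u"
  proof
    fix u assume u: "u \<in> W"
    have "(\<Sum>j\<in>UNIV. A $ i $ j * (\<Sum>v\<in>W. kronecker_power A u v * f (j # v))) = c * f (i # u)"
      for i
      using Suc.prems(1)[of "i # u"] u
      by (simp add: sum_words_Suc W_def sum_distrib_left mult.assoc)
    then show "A *v (\<Sum>v\<in>W. kronecker_power A u v *s g v) = c *s g u"
      by (simp add: vec_eq_iff matrix_vector_mult_def g_def)
  qed
  have nz: "\<exists>u\<in>W. g u \<noteq> 0"
    using Suc.prems(2) by (auto simp: length_Suc_conv W_def g_def vec_eq_iff)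
  from g nz show ?case
  proof (cases rule: kronecker_eigenvalue)
    \<comment> \<open>The single factor 0 already has product \<open>c\<close>; the induction
      hypothesis is not called.\<close>
    case zero
    then show ?thesis
      by (intro exI[of _ "[0]"]) simp
  next
    case (mult \<mu> d h)
    then obtain \<mu>s where "\<forall>\<mu>\<in>set \<mu>s. matrix_eigenvalue A \<mu>" "d = prod_list \<mu>s"
      using Suc.IH[of h d] by (auto simp: W_def)
    with mult show ?thesis
      by (intro exI[of _ "\<mu> # \<mu>s"]) simp
  qed
qed

section \<open>Comparison of coefficients in lowest degree\<close>

lemma nc_coeff_sum: "nc_coeff (\<Sum>i\<in>S. f i) w = (\<Sum>i\<in>S. nc_coeff (f i) w)"
  by (induction S rule: infinite_finite_induct) auto

lemma nc_coeff_linear: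
  "nc_coeff (nc_linear A j) w = (case w of [i] \<Rightarrow> A $ i $ j | _ \<Rightarrow> 0)"
  by (auto simp: nc_linear_def nc_coeff_sum nc_coeff_var if_distrib[of "(*) _"] cong: if_cong
      split: list.split)

text \<open>There are as many factors as letters and no factor has a constant term, so each factor
  must take exactly one letter and only linear coefficients enter.\<close>

lemma nc_word_coeff_same_length:
  fixes A :: "complex ^ 'n ^ 'n"
  assumes const: "\<And>j. nc_coeff (\<Lambda> j) [] = 0"
    and lin: "\<And>i j. nc_coeff (\<Lambda> j) [i] = A $ i $ j"
    and "length w = length \<alpha>"
  shows "nc_coeff (nc_word \<Lambda> \<alpha>) w = kronecker_power A w \<alpha>"
  using assms(3)
proof (induction w \<alpha> rule: list_induct2)
  case Nil
  then show ?case
    by (simp add: nc_word_def nc_coeff_1)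
next
  case (Cons x w y \<alpha>)
  \<comment> \<open>Cutting at 0 meets a zero constant term; cutting beyond 1 leaves fewer letters
    than remaining factors.\<close>
  have "nc_coeff (\<Lambda> y) (take i (x # w)) * nc_coeff (nc_word \<Lambda> \<alpha>) (drop i (x # w)) =
      (if i = 1 then A $ x $ y * kronecker_power A w \<alpha> else 0)" if "i \<le> length (x # w)" for i
  proof -
    consider "i = 0" | "i = 1" | "i > 1"
      by linarith
    then show ?thesis
    proof cases
      case 3
      then have "nc_coeff (nc_word \<Lambda> \<alpha>) (drop i (x # w)) = 0"
        using Cons.hyps that by (intro nc_word_coeff_short[OF const]) auto
      with 3 show ?thesis
        by simp
    qed (simp_all add: const lin Cons.IH)
  qed
  then have "nc_coeff (nc_word \<Lambda> (y # \<alpha>)) (x # w) =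
      (\<Sum>i\<le>length (x # w). if i = 1 then A $ x $ y * kronecker_power A w \<alpha> else 0)"
    unfolding nc_word_def list.map prod_list.Cons nc_coeff_mult by (intro sum.cong) auto
  then show ?case
    by (simp add: Suc_le_eq)
qed

theorem theorem6p1:
  fixes A :: "complex ^ 'n ^ 'n"
    and \<Lambda> \<Gamma> :: "'n::finite \<Rightarrow> 'n ncps"
    and F :: "'n ncps"
    and c :: complex
  assumes \<Lambda>: "\<And>j. \<Lambda> j = nc_linear A j + \<Gamma> j"
    and \<Gamma>: "\<And>j w. length w < 2 \<Longrightarrow> nc_coeff (\<Gamma> j) w = 0"
    and F: "F \<noteq> 0"
    and eq: "nc_compose F \<Lambda> = nc_scale c F"
  shows "c = 1 \<or>
    (\<exists>\<mu>s. \<mu>s \<noteq> [] \<and> (\<forall>\<mu>\<in>set \<mu>s. matrix_eigenvalue A \<mu>) \<and> c = prod_list \<mu>s)"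
proof -
  have const: "nc_coeff (\<Lambda> j) [] = 0" for j
    by (simp add: \<Lambda> \<Gamma> nc_coeff_linear)
  have lin: "nc_coeff (\<Lambda> j) [i] = A $ i $ j" for i j
    by (simp add: \<Lambda> \<Gamma> nc_coeff_linear)
  define k where "k = (LEAST k. \<exists>w. length w = k \<and> nc_coeff F w \<noteq> 0)"
  have "\<exists>k w. length w = k \<and> nc_coeff F w \<noteq> 0"
    using F by (auto intro!: ncps_eqI)
  then have k: "\<exists>w. length w = k \<and> nc_coeff F w \<noteq> 0"
    unfolding k_def by (rule LeastI_ex)
  have less: "nc_coeff F \<alpha> = 0" if "length \<alpha> < k" for \<alpha>
    using not_less_Least[OF that[unfolded k_def]] by auto
  have "(\<Sum>\<alpha> | length \<alpha> = k. kronecker_power A w \<alpha> * nc_coeff F \<alpha>) = c * nc_coeff F w"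
    if w: "length w = k" for w
  proof -
    have "c * nc_coeff F w =
        (\<Sum>j\<le>k. \<Sum>\<alpha> | length \<alpha> = j. nc_coeff F \<alpha> * nc_coeff (nc_word \<Lambda> \<alpha>) w)"
      using arg_cong[OF eq, of "\<lambda>G. nc_coeff G w"] w by (simp add: nc_coeff_compose[OF const])
    \<comment> \<open>Degrees below \<open>k\<close> drop out by minimality of \<open>k\<close>;
      those above it are already absent from the composition formula.\<close>
    also have "\<dots> = (\<Sum>\<alpha> | length \<alpha> = k. nc_coeff F \<alpha> * nc_coeff (nc_word \<Lambda> \<alpha>) w)"
      by (simp add: sum.remove[of "{..k}" k]) (auto intro!: sum.neutral simp: less)
    also have "\<dots> = (\<Sum>\<alpha> | length \<alpha> = k. kronecker_power A w \<alpha> * nc_coeff F \<alpha>)"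
      using w by (intro sum.cong)
        (auto simp: nc_word_coeff_same_length[where A = A, OF const lin])
    finally show ?thesis ..
  qed
  from kronecker_power_eigenvalue[OF this k] obtain \<mu>s
    where "\<forall>\<mu>\<in>set \<mu>s. matrix_eigenvalue A \<mu>" "c = prod_list \<mu>s"
    by blast
  then show ?thesis
    \<comment> \<open>The empty product is the alternative \<open>c = 1\<close>.\<close>
    by (cases "\<mu>s = []") auto
qed

end
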